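(* Let $q\ge 1$ be an integer and let $z\in\mathbb{C}$. The generating function of the sequence $\left\{\binom{nz}{n}_q\right\}_{n\ge 0}$ is given by $$\sum_{n\ge 0}\binom{nz}{n}_q t^n=\left(1-z\,\frac{u+2u^2+\cdots+qu^q}{1+u+u^2+\cdots+u^q}\right)^{-1},$$ as an identity of formal power series in $t$, where $u=u(t)$ is the formal power series with zero constant term that solves the equation $$t=u\left(1+u+u^2+\cdots+u^q\right)^{-z}.$$
   Context: For $w\in\mathbb{C}$ and integers $q\ge1$, $k\ge 0$, the generalized ordinary multinomial is $$\binom{w}{k}_q:=\sum_{k_1+k_2+\cdots+k_q=k}\frac{w(w-1)\cdots(w-k_1+1)}{(k_1-k_2)!\,(k_2-k_3)!\cdots(k_{q-1}-k_q)!\,k_q!},$$ the sum running over nonnegative integers $k_1,\ldots,k_q$ with sum $k$, where a term is $0$ as soon as some $k_i<k_{i+1}$ (reciprocal of the factorial of a negative integer is $0$), and the numerator is $1$ when $k_1=0$. For complex $w$, $(1+u+\cdots+u^q)^w$ denotes the formal power series $\sum_{m\ge0}\frac{w(w-1)\cdots(w-m+1)}{m!}(u+u^2+\cdots+u^q)^m$. *)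

theory Defs
  imports "HOL-Computational_Algebra.Formal_Power_Series"
begin

text \<open>
  The tuples \<open>(k\<^sub>1, \<dots>, k\<^sub>q)\<close> are extensional functions on \<open>{1..q}\<close>. The bound \<open>\<le> n\<close> on their
  values is implied by the sum condition and only makes the index set visibly finite.
\<close>

definition weak_compositions :: "nat \<Rightarrow> nat \<Rightarrow> (nat \<Rightarrow> nat) set" where
  "weak_compositions q n = {k \<in> {1..q} \<rightarrow>\<^sub>E {..n}. (\<Sum>i=1..q. k i) = n}"

text \<open>
  The conditional implements the convention that the reciprocal of the factorial of a negative
  integer is 0; in the other branch the subtractions on \<^typ>\<open>nat\<close> do not truncate.
  The definition is meant for \<open>q \<ge> 1\<close>.
\<close>

definition gen_multinomial :: "nat \<Rightarrow> complex \<Rightarrow> nat \<Rightarrow> complex" where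
  "gen_multinomial q w n =
     (\<Sum>k \<in> weak_compositions q n.
        if \<exists>i\<in>{1..<q}. k i < k (i + 1) then 0
        else (\<Prod>j<k 1. w - of_nat j) /
             ((\<Prod>i\<in>{1..<q}. fact (k i - k (i + 1))) * fact (k q)))"

text \<open>
  \<open>geom_powr q u w\<close> is \<open>(1 + u + \<dots> + u\<^sup>q)\<^sup>w\<close>, that is
  \<open>\<Sum>m. (w gchoose m) * (u + u\<^sup>2 + \<dots> + u\<^sup>q)\<^sup>m\<close>, for \<open>u\<close> with zero constant term.
  The lemma \<open>geom_powr_sums\<close> below shows that the composition is this infinite sum.
\<close>

definition geom_powr :: "nat \<Rightarrow> complex fps \<Rightarrow> complex \<Rightarrow> complex fps" where
  "geom_powr q u w = fps_compose (fps_binomial w) (\<Sum>i=1..q. u ^ i)"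

lemma geom_powr_sums:
  assumes "fps_nth u 0 = 0"
  shows "(\<lambda>m. fps_const (w gchoose m) * (\<Sum>i=1..q. u ^ i) ^ m) sums geom_powr q u w"
proof -
  define v where "v = (\<Sum>i=1..q. u ^ i)"
  have v0: "fps_nth v 0 = 0"
    unfolding v_def fps_sum_nth
    by (intro sum.neutral ballI) (use assms in \<open>auto simp: fps_power_zeroth\<close>)
  have "(\<lambda>n. \<Sum>m<n. fps_const (w gchoose m) * v ^ m) \<longlonglongrightarrow> geom_powr q u w"
  proof (rule tendsto_fpsI)
    fix n
    show "eventually (\<lambda>x. fps_nth (\<Sum>m<x. fps_const (w gchoose m) * v ^ m) n =
                          fps_nth (geom_powr q u w) n) sequentially"
    proof (rule eventually_sequentiallyI[of "Suc n"])
      fix x assume "Suc n \<le> x"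
      have "(\<Sum>m<x. (w gchoose m) * fps_nth (v ^ m) n) = 
            (\<Sum>m=0..n. (w gchoose m) * fps_nth (v ^ m) n)"
        by (rule sum.mono_neutral_right)
           (use \<open>Suc n \<le> x\<close> v0 in \<open>auto simp: startsby_zero_power_prefix\<close>)
      then show "fps_nth (\<Sum>m<x. fps_const (w gchoose m) * v ^ m) n =
                 fps_nth (geom_powr q u w) n"
        by (simp add: geom_powr_def v_def fps_compose_nth fps_sum_nth)
    qed
  qed
  then show ?thesis by (simp add: sums_def v_def)
qed

end

theory Submission imports Defs begin

text \<open>
  Peeling off the first index of the tuples, via \<open>x + \<dots> + x\<^sup>q = x (1 + (x + \<dots> + x\<^sup>q\<^sup>-\<^sup>1))\<close>
  and the binomial theorem, shows that the generalized multinomial of \<open>w\<close> and \<open>n\<close> is the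
  coefficient of \<open>x\<^sup>n\<close> in \<open>(1 + x + \<dots> + x\<^sup>q)\<^sup>w\<close>. With \<open>\<phi> = (1 + x + \<dots> + x\<^sup>q)\<^sup>z\<close> the coefficients
  sought are therefore those of \<open>x\<^sup>n\<close> in \<open>\<phi>\<^sup>n\<close>, and \<open>u\<close> is the compositional inverse of
  \<open>f = x / \<phi>\<close>. Lagrange inversion applied to \<open>1 / (\<phi> f')\<close> gives the theorem, because
  \<open>\<phi> f' = 1 - x \<phi>' / \<phi>\<close>.
\<close>

section \<open>Lagrange inversion for formal power series\<close>

text \<open>
  By linearity it suffices to take \<open>c = x\<^sup>k\<close>; for \<open>p = n - k > 0\<close> the claim is that
  \<open>\<phi>\<^sup>p - x (\<phi>\<^sup>p)' / p\<close> has no \<open>x\<^sup>p\<close> term.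
\<close>

lemma lagrange_inversion_fps:
  fixes f \<phi> c :: "'a :: field_char_0 fps"
  assumes f0: "fps_nth f 0 = 0" and f\<phi>: "f * \<phi> = fps_X"
  shows "fps_nth ((c oo f) * \<phi> ^ Suc n * fps_deriv f) n = fps_nth c n"
proof -
  have deriv: "fps_deriv f * \<phi> = 1 - f * fps_deriv \<phi>"
  proof -
    have "fps_deriv (f * \<phi>) = 1" by (simp add: f\<phi>)
    then show ?thesis by (simp add: algebra_simps)
  qed
  have orth: "fps_nth (f ^ k * \<phi> ^ Suc n * fps_deriv f) n = (if k = n then 1 else 0)"
    if "k \<le> n" for k
  proof -
    obtain p where n: "n = k + p" using le_Suc_ex[OF \<open>k \<le> n\<close>] by blast
    have "f ^ k * \<phi> ^ Suc n * fps_deriv f = (f * \<phi>) ^ k * (\<phi> ^ p * (fps_deriv f * \<phi>))"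
      by (simp add: n power_add power_mult_distrib)
    also have "\<dots> = fps_X ^ k * (\<phi> ^ p * (1 - f * fps_deriv \<phi>))"
      by (simp add: f\<phi> deriv)
    finally have "fps_nth (f ^ k * \<phi> ^ Suc n * fps_deriv f) n
        = fps_nth (\<phi> ^ p * (1 - f * fps_deriv \<phi>)) p"
      by (simp add: n fps_X_power_mult_nth)
    also have "\<dots> = (if p = 0 then 1 else 0)"
    proof (cases p)
      case 0
      then show ?thesis by (simp add: f0)
    next
      case (Suc r)
      \<comment> \<open>With p = r + 1, the factor p turns
        \<open>fps_deriv \<phi> * \<phi> ^ r\<close> into the derivative of
        \<open>\<phi> ^ p\<close>. At degree p both terms then have p times the coefficient of
        \<open>\<phi> ^ p\<close>, and p cancels in characteristic 0.\<close>
      have "of_nat p * (\<phi> ^ p * (1 - f * fps_deriv \<phi>))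
          = of_nat p * \<phi> ^ p - (f * \<phi>) * (of_nat p * fps_deriv \<phi> * \<phi> ^ r)"
        by (simp add: Suc algebra_simps)
      also have "\<dots> = of_nat p * \<phi> ^ p - fps_X * fps_deriv (\<phi> ^ p)"
        unfolding fps_deriv_power by (simp add: f\<phi> Suc fps_of_nat del: of_nat_Suc)
      finally have "fps_nth (of_nat p * (\<phi> ^ p * (1 - f * fps_deriv \<phi>))) p
          = fps_nth (of_nat p * \<phi> ^ p - fps_X * fps_deriv (\<phi> ^ p)) p" by simp
      also have "\<dots> = 0" by (simp add: Suc del: power_Suc of_nat_Suc)
      finally show ?thesis by (simp add: Suc del: of_nat_Suc)
    qed
    finally show ?thesis by (simp add: n)
  qed
  define A where "A = \<phi> ^ Suc n * fps_deriv f"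
  \<comment> \<open>\<open>f ^ k\<close> has no terms below degree k, so the same cut-off n serves
    every i \<le> n. A range independent of i permits the interchange of sums below.\<close>
  have trunc: "fps_nth (c oo f) i = (\<Sum>k\<le>n. fps_nth c k * fps_nth (f ^ k) i)" if "i \<le> n" for i
    unfolding fps_compose_nth using that
    by (intro sum.mono_neutral_left) (auto simp: f0 startsby_zero_power_prefix)
  have "fps_nth ((c oo f) * A) n
      = (\<Sum>i=0..n. (\<Sum>k\<le>n. fps_nth c k * fps_nth (f ^ k) i) * fps_nth A (n - i))"
    unfolding fps_mult_nth by (intro sum.cong refl) (simp add: trunc)
  also have "\<dots> = (\<Sum>k\<le>n. fps_nth c k * fps_nth (f ^ k * A) n)"
    unfolding fps_mult_nth sum_distrib_left sum_distrib_right mult.assoc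
    by (rule sum.swap)
  also have "\<dots> = (\<Sum>k\<le>n. if k = n then fps_nth c n else 0)"
    using orth by (intro sum.cong refl) (auto simp: A_def mult.assoc)
  also have "\<dots> = fps_nth c n" by simp
  finally show ?thesis by (simp add: A_def mult.assoc)
qed

section \<open>Generalized multinomials as coefficients\<close>

text \<open>
  Tuples that are not nonincreasing contribute 0, since then some binomial coefficient vanishes.
  The bound \<open>N\<close> is kept independent of \<open>m\<close> so that it can stay fixed in the induction.
\<close>

lemma power_geometric_sum_expansion:
  fixes x :: "'a :: comm_semiring_1"
  assumes "m \<le> N"
  shows "(\<Sum>i=1..Suc d. x ^ i) ^ m = (\<Sum>k\<in>{s..s+d} \<rightarrow>\<^sub>E {..N}.
           if k s = m then of_nat (\<Prod>i\<in>{s..<s+d}. k i choose k (Suc i)) * x ^ (\<Sum>i=s..s+d. k i) else 0)"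
  using assms
proof (induction d arbitrary: s m)
  case 0
  have "(\<Sum>k\<in>{s} \<rightarrow>\<^sub>E {..N}. if k s = m then x ^ k s else 0)
      = (\<Sum>b\<le>N. if b = m then x ^ b else 0)"
    by (rule sum.reindex_bij_witness[of _ "\<lambda>b. \<lambda>i\<in>{s}. b" "\<lambda>k. k s"])
       (auto simp: PiE_def extensional_def fun_eq_iff)
  also have "\<dots> = x ^ m" using 0 by simp
  finally show ?case by (simp cong: if_cong)
next
  case (Suc d)
  define V where "V = (\<Sum>i=1..Suc d. x ^ i)"
  define T where "T = {Suc s..Suc s + d}"
  define P where "P = (\<lambda>g :: nat \<Rightarrow> nat. \<Prod>i\<in>{Suc s..<Suc s + d}. g i choose g (Suc i))"
  have V: "(\<Sum>i=1..Suc (Suc d). x ^ i) = x * (V + 1)"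
  proof -
    have "(\<Sum>i=Suc 1..Suc (Suc d). x ^ i) = x * V"
      unfolding sum.shift_bounds_cl_Suc_ivl V_def sum_distrib_left by simp
    then show ?thesis
      by (subst sum.atLeast_Suc_atMost) (simp_all add: distrib_left add.commute del: sum.cl_ivl_Suc)
  qed
  have T: "{s..s + Suc d} = insert s T" "s \<notin> T" "finite T" by (auto simp: T_def)
  let ?F = "\<lambda>k. if k s = m then of_nat (\<Prod>i\<in>{s..<s+Suc d}. k i choose k (Suc i))
                  * x ^ (\<Sum>i=s..s+Suc d. k i) else 0"
  \<comment> \<open>The first entry a = m supplies \<open>x ^ m\<close>; a single binomial
    coefficient links it to the remaining tuple g.\<close>
  have F: "?F (g(s := a)) = (if a = m then x ^ m * (of_nat (m choose g (Suc s)) *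
             (of_nat (P g) * x ^ sum g T)) else 0)" for a g
  proof -
    have prod_upd: "(\<Prod>i\<in>{s..<s+Suc d}. (g(s := a)) i choose (g(s := a)) (Suc i))
        = (a choose g (Suc s)) * P g"
      unfolding P_def by (subst prod.atLeast_Suc_lessThan) auto
    have sum_upd: "(\<Sum>i=s..s+Suc d. (g(s := a)) i) = a + sum g T"
      unfolding T(1) using T(2,3) by (auto intro!: sum.cong)
    show ?thesis unfolding prod_upd sum_upd by (simp add: power_add mult_ac)
  qed
  have "(\<Sum>k\<in>{s..s+Suc d} \<rightarrow>\<^sub>E {..N}. ?F k)
      = (\<Sum>(a, g)\<in>{..N} \<times> (T \<rightarrow>\<^sub>E {..N}). ?F (g(s := a)))"
    unfolding T(1) PiE_insert_eq
    by (subst sum.reindex[OF inj_combinator[OF T(2)]]) (simp add: case_prod_unfold o_def)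
  also have "\<dots> = (\<Sum>a\<le>N. if a = m then \<Sum>g\<in>T \<rightarrow>\<^sub>E {..N}. x ^ m * (of_nat (m choose g (Suc s)) *
             (of_nat (P g) * x ^ sum g T)) else 0)"
    unfolding sum.cartesian_product[symmetric] F by (intro sum.cong refl) auto
  also have "\<dots> = x ^ m * (\<Sum>g\<in>T \<rightarrow>\<^sub>E {..N}. of_nat (m choose g (Suc s)) *
             (of_nat (P g) * x ^ sum g T))"
    using Suc.prems by (simp add: sum_distrib_left)
  \<comment> \<open>Grouping the tuples by their first entry j produces the inner sums that the
    induction hypothesis evaluates as \<open>V ^ j\<close>.\<close>
  also have "(\<Sum>g\<in>T \<rightarrow>\<^sub>E {..N}. of_nat (m choose g (Suc s)) * (of_nat (P g) * x ^ sum g T))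
      = (\<Sum>g\<in>T \<rightarrow>\<^sub>E {..N}. \<Sum>j\<le>N. if g (Suc s) = j
           then of_nat (m choose j) * (of_nat (P g) * x ^ sum g T) else 0)"
  proof (intro sum.cong refl)
    fix g assume "g \<in> T \<rightarrow>\<^sub>E {..N}"
    then have "g (Suc s) \<le> N" by (auto simp: T_def PiE_iff)
    then show "of_nat (m choose g (Suc s)) * (of_nat (P g) * x ^ sum g T)
      = (\<Sum>j\<le>N. if g (Suc s) = j then of_nat (m choose j) * (of_nat (P g) * x ^ sum g T) else 0)"
      by simp
  qed
  also have "\<dots> = (\<Sum>j\<le>N. of_nat (m choose j) * (\<Sum>g\<in>T \<rightarrow>\<^sub>E {..N}. if g (Suc s) = j
           then of_nat (P g) * x ^ sum g T else 0))"
    by (subst sum.swap) (simp add: sum_distrib_left if_distrib cong: if_cong)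
  also have "\<dots> = (\<Sum>j\<le>N. of_nat (m choose j) * V ^ j)"
    unfolding V_def P_def T_def
    by (intro sum.cong refl arg_cong2[where f = "(*)"]) (rule Suc.IH[symmetric], simp)
  \<comment> \<open>The terms with j > m vanish, which leaves the full binomial expansion.\<close>
  also have "\<dots> = (\<Sum>j\<le>m. of_nat (m choose j) * V ^ j)"
    using Suc.prems by (intro sum.mono_neutral_right) (auto simp: binomial_eq_0)
  also have "\<dots> = (V + 1) ^ m" by (simp add: binomial_ring)
  finally show ?case by (simp only: V power_mult_distrib)
qed

text \<open>The product telescopes: the lower factorial of each binomial coefficient cancels the
  upper one of the next. The surviving \<open>fact (k s)\<close> later cancels the denominator of
  \<open>w gchoose k 1\<close>.\<close>

lemma prod_choose_eq_fact_div:
  fixes k :: "nat \<Rightarrow> nat"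
  assumes "\<forall>i\<in>{s..<s+d}. k (Suc i) \<le> k i"
  shows "of_nat (\<Prod>i\<in>{s..<s+d}. k i choose k (Suc i)) =
         (fact (k s) / ((\<Prod>i\<in>{s..<s+d}. fact (k i - k (Suc i))) * fact (k (s+d))) :: 'a :: field_char_0)"
  using assms
proof (induction d)
  case (Suc d)
  have "k (Suc (s + d)) \<le> k (s + d)" using Suc.prems by auto
  then show ?case using Suc by (simp add: binomial_fact)
qed simp

text \<open>In the expansion of the m-th power only tuples with k 1 = m occur, so summing over m
  puts the weight \<open>w gchoose k 1\<close> on each tuple. Taking the coefficient at n keeps
  exactly the tuples with sum n.\<close>

lemma gen_multinomial_eq_nth:
  assumes "q \<ge> 1"
  shows "gen_multinomial q w n = fps_nth (geom_powr q fps_X w) n"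
proof -
  obtain d where q: "q = 1 + d" using le_Suc_ex[OF assms] by blast
  let ?E = "{1..q} \<rightarrow>\<^sub>E {..n}"
  let ?P = "\<lambda>k :: nat \<Rightarrow> nat. \<Prod>i\<in>{1..<q}. k i choose k (Suc i)"
  have E: "finite ?E" by (intro finite_PiE) auto
  have "fps_nth (geom_powr q fps_X w) n
      = (\<Sum>m=0..n. (w gchoose m) * fps_nth ((\<Sum>i=1..q. fps_X ^ i) ^ m) n)"
    by (simp add: geom_powr_def fps_compose_nth)
  also have "\<dots> = (\<Sum>m=0..n. (w gchoose m) * (\<Sum>k\<in>?E.
      if k 1 = m then of_nat (?P k) * (if (\<Sum>i=1..q. k i) = n then 1 else 0) else 0))"
  proof (intro sum.cong refl)
    fix m assume "m \<in> {0..n}"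
    then have *: "(\<Sum>i=1..q. fps_X ^ i :: complex fps) ^ m = (\<Sum>k\<in>?E.
        if k 1 = m then of_nat (?P k) * fps_X ^ (\<Sum>i=1..q. k i) else 0)"
      using power_geometric_sum_expansion[of m n "fps_X :: complex fps" d 1] unfolding q by simp
    show "(w gchoose m) * fps_nth ((\<Sum>i=1..q. fps_X ^ i) ^ m) n = (w gchoose m) * (\<Sum>k\<in>?E.
      if k 1 = m then of_nat (?P k) * (if (\<Sum>i=1..q. k i) = n then 1 else 0) else 0)"
      unfolding * fps_sum_nth
      by (intro arg_cong2[where f = "(*)"] sum.cong refl)
         (auto simp: simp del: of_nat_prod)
  qed
  also have "\<dots> = (\<Sum>k\<in>?E. \<Sum>m=0..n. if k 1 = m then
      (w gchoose m) * (of_nat (?P k) * (if (\<Sum>i=1..q. k i) = n then 1 else 0)) else 0)"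
    unfolding sum_distrib_left
    by (subst sum.swap) (intro sum.cong refl, auto)
  also have "\<dots> = (\<Sum>k\<in>?E. if (\<Sum>i=1..q. k i) = n then (w gchoose k 1) * of_nat (?P k) else 0)"
  proof (intro sum.cong refl)
    fix k assume "k \<in> ?E"
    then have "k 1 \<le> n" using assms by (auto simp: PiE_iff)
    then show "(\<Sum>m=0..n. if k 1 = m then
      (w gchoose m) * (of_nat (?P k) * (if (\<Sum>i=1..q. k i) = n then 1 else 0)) else 0)
      = (if (\<Sum>i=1..q. k i) = n then (w gchoose k 1) * of_nat (?P k) else 0)"
      by (simp del: of_nat_prod)
  qed
  also have "\<dots> = (\<Sum>k\<in>weak_compositions q n. (w gchoose k 1) * of_nat (?P k))"
    unfolding weak_compositions_def using E by (rule sum.inter_filter[symmetric])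
  also have "\<dots> = gen_multinomial q w n"
    unfolding gen_multinomial_def
  proof (intro sum.cong refl)
    fix k
    show "(w gchoose k 1) * of_nat (?P k) =
        (if \<exists>i\<in>{1..<q}. k i < k (i + 1) then 0
         else (\<Prod>j<k 1. w - of_nat j) / ((\<Prod>i\<in>{1..<q}. fact (k i - k (i + 1))) * fact (k q)))"
    proof (cases "\<exists>i\<in>{1..<q}. k i < k (i + 1)")
      case True
      then have "?P k = 0" by (intro prod_zero) auto
      with True show ?thesis by (simp del: of_nat_prod)
    next
      case False
      then have "of_nat (?P k) =
          (fact (k 1) / ((\<Prod>i\<in>{1..<q}. fact (k i - k (i + 1))) * fact (k q)) :: complex)"
        using prod_choose_eq_fact_div[of 1 d k] by (simp add: q not_less del: of_nat_prod)
      with False show ?thesis by (simp add: gbinomial_prod_rev atLeast0LessThan del: of_nat_prod)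
    qed
  qed
  finally show ?thesis ..
qed

section \<open>Calculus of complex powers of 1 + u + ... + u^q\<close>

lemma fps_nth_sum_powers_0:
  assumes "fps_nth (u :: 'a :: comm_semiring_1 fps) 0 = 0"
  shows "fps_nth (\<Sum>i=1..q. u ^ i) 0 = 0"
  unfolding fps_sum_nth using assms by (intro sum.neutral) (auto simp: fps_power_zeroth power_0_left)

lemma geom_powr_compose:
  assumes "fps_nth u 0 = 0" "fps_nth v 0 = 0"
  shows "geom_powr q v w oo u = geom_powr q (v oo u) w"
  using fps_compose_power[OF assms(1), of v]
  by (simp add: geom_powr_def fps_compose_assoc[symmetric] assms fps_nth_sum_powers_0
      fps_compose_sum_distrib del: One_nat_def)

lemma geom_powr_add:
  assumes "fps_nth u 0 = 0"
  shows "geom_powr q u (v + w) = geom_powr q u v * geom_powr q u w"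
  unfolding geom_powr_def fps_binomial_add_mult
  by (simp add: fps_compose_mult_distrib fps_nth_sum_powers_0 assms
      del: One_nat_def)

lemma geom_powr_of_nat_mult:
  assumes "fps_nth u 0 = 0"
  shows "geom_powr q u (of_nat n * w) = geom_powr q u w ^ n"
  by (simp add: geom_powr_def fps_binomial_power[symmetric] fps_compose_power fps_nth_sum_powers_0 assms
      del: One_nat_def)

lemma geom_powr_0 [simp]: "geom_powr q u 0 = 1"
  by (simp add: geom_powr_def)

lemma geom_powr_nth_0 [simp]: "fps_nth (geom_powr q u w) 0 = 1"
  by (simp add: geom_powr_def)

text \<open>This is a logarithmic derivative: the chain rule is applied to the binomial series B,
  which satisfies (1 + X) B' = w B, at V = X + ... + X^q.\<close>

lemma fps_X_mult_deriv_geom_powr: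
  "fps_X * fps_deriv (geom_powr q fps_X w) =
     fps_const w * geom_powr q fps_X w * ((\<Sum>i=1..q. of_nat i * fps_X ^ i) / (\<Sum>i=0..q. fps_X ^ i))"
proof -
  define V :: "complex fps" where "V = (\<Sum>i=1..q. fps_X ^ i)"
  have V0: "fps_nth V 0 = 0" unfolding V_def by (rule fps_nth_sum_powers_0) simp
  have S: "(\<Sum>i=0..q. fps_X ^ i) = 1 + V"
    by (simp add: V_def sum.atLeast_Suc_atMost)
  have XV: "fps_X * fps_deriv V = (\<Sum>i=1..q. of_nat i * fps_X ^ i)"
    unfolding V_def fps_deriv_sum sum_distrib_left
  proof (intro sum.cong refl)
    fix i assume "i \<in> {1..q}"
    then obtain j where "i = Suc j" by (cases i) auto
    then show "fps_X * fps_deriv (fps_X ^ i) = of_nat i * (fps_X ^ i :: complex fps)"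
      unfolding fps_deriv_power by (simp add: fps_of_nat mult_ac del: of_nat_Suc)
  qed
  have "fps_deriv (geom_powr q fps_X w)
      = (fps_const w * fps_binomial w / (1 + fps_X) oo V) * fps_deriv V"
    unfolding geom_powr_def V_def[symmetric] fps_compose_deriv[OF V0] fps_binomial_deriv ..
  also have "fps_const w * fps_binomial w / (1 + fps_X) oo V
      = fps_const w * geom_powr q fps_X w / (1 + V)"
    unfolding geom_powr_def V_def[symmetric]
    by (simp add: fps_divide_compose V0 fps_compose_mult_distrib fps_compose_add_distrib)
  finally show ?thesis
    unfolding S XV[symmetric] by (simp add: fps_divide_unit V0)
qed

section \<open>Compositional inverse and generating function\<close>

text \<open>By associativity a right inverse agrees with the left inverse \<open>fps_inv f\<close>.
  This gives the uniqueness of the solution u.\<close>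

lemma fps_inv_unique:
  fixes f u :: "'a :: field fps"
  assumes "fps_nth f 0 = 0" "fps_nth f 1 \<noteq> 0" "fps_nth u 0 = 0" "f oo u = fps_X"
  shows "u = fps_inv f"
proof -
  have "u = (fps_inv f oo f) oo u" using assms by (simp add: fps_inv)
  also have "\<dots> = fps_inv f oo (f oo u)" using assms by (simp add: fps_compose_assoc[symmetric])
  finally show ?thesis using assms by simp
qed

theorem theorem10:
  fixes q :: nat and z :: complex
  assumes "q \<ge> 1"
  shows "(\<exists>!u :: complex fps. fps_nth u 0 = 0 \<and> fps_X = u * geom_powr q u (- z)) \<and>
         (\<forall>u :: complex fps. fps_nth u 0 = 0 \<and> fps_X = u * geom_powr q u (- z) \<longrightarrow>
            Abs_fps (\<lambda>n. gen_multinomial q (of_nat n * z) n) =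
            inverse (1 - fps_const z * ((\<Sum>i=1..q. of_nat i * u ^ i) / (\<Sum>i=0..q. u ^ i))))"
proof -
  define f where "f = fps_X * geom_powr q fps_X (- z)"
  define \<phi> where "\<phi> = geom_powr q fps_X z"
  define D where "D = 1 - fps_const z *
    ((\<Sum>i=1..q. of_nat i * fps_X ^ i) / (\<Sum>i=0..q. fps_X ^ i :: complex fps))"
  have f0: "fps_nth f 0 = 0" and f1: "fps_nth f 1 \<noteq> 0" by (simp_all add: f_def)
  have inv: "geom_powr q fps_X (- z) * \<phi> = 1"
    by (simp add: \<phi>_def geom_powr_add[symmetric])
  have f\<phi>: "f * \<phi> = fps_X" by (simp add: f_def mult.assoc inv)
  have eq_iff: "fps_X = u * geom_powr q u (- z) \<longleftrightarrow> f oo u = fps_X" if "fps_nth u 0 = 0" for u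
    using that by (auto simp: f_def fps_compose_mult_distrib geom_powr_compose)
  have solves: "fps_nth u 0 = 0 \<and> fps_X = u * geom_powr q u (- z) \<longleftrightarrow> u = fps_inv f" for u
    using eq_iff fps_inv_unique[OF f0 f1] fps_inv_right[OF f0 f1] by (auto simp: fps_inv_def)
  \<comment> \<open>Writing f with exponent -z makes the derivative formula yield the minus sign
    directly; \<open>inv\<close> cancels the two opposite powers.\<close>
  have D: "D = \<phi> * fps_deriv f"
  proof -
    have "\<phi> * fps_deriv f = geom_powr q fps_X (- z) * \<phi>
        + \<phi> * (fps_X * fps_deriv (geom_powr q fps_X (- z)))"
      by (simp add: f_def algebra_simps)
    also have "\<phi> * (fps_X * fps_deriv (geom_powr q fps_X (- z)))
        = - (fps_const z * (geom_powr q fps_X (- z) * \<phi>) *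
           ((\<Sum>i=1..q. of_nat i * fps_X ^ i) / (\<Sum>i=0..q. fps_X ^ i)))"
      unfolding fps_X_mult_deriv_geom_powr by (simp add: mult_ac flip: fps_const_neg)
    finally show ?thesis by (simp add: D_def inv del: One_nat_def)
  qed
  \<comment> \<open>A denominator with constant term 1 is a unit, so substituting u commutes with
    the quotient in \<open>D\<close>.\<close>
  have S0: "fps_nth (\<Sum>i=0..q. v ^ i) 0 = 1" if "fps_nth v 0 = 0" for v :: "complex fps"
    using fps_nth_sum_powers_0[OF that] by (simp add: sum.atLeast_Suc_atMost)
  have D0: "fps_nth D 0 \<noteq> 0"
    by (simp add: D f_def \<phi>_def)
  have "Abs_fps (\<lambda>n. gen_multinomial q (of_nat n * z) n) =
      inverse (1 - fps_const z * ((\<Sum>i=1..q. of_nat i * u ^ i) / (\<Sum>i=0..q. u ^ i)))"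
    if u: "u = fps_inv f" for u
  proof -
    have u0: "fps_nth u 0 = 0" by (simp add: u fps_inv_def)
    \<comment> \<open>The series \<open>inverse D oo u\<close> is chosen so that composing it with f
      returns \<open>inverse D\<close>. This cancels one factor \<open>\<phi> * fps_deriv f\<close>
      in the Lagrange formula and leaves \<open>\<phi> ^ n\<close>.\<close>
    have "fps_nth (inverse D oo u) n = gen_multinomial q (of_nat n * z) n" for n
    proof -
      have "(inverse D oo u) oo f = inverse D"
        using u0 by (simp add: u fps_compose_assoc[symmetric] f0 fps_inv[OF f0 f1])
      then have "fps_nth (inverse D oo u) n = fps_nth (inverse D * \<phi> ^ Suc n * fps_deriv f) n"
        using lagrange_inversion_fps[OF f0 f\<phi>, of "inverse D oo u" n] by simp
      also have "inverse D * \<phi> ^ Suc n * fps_deriv f = (inverse D * D) * \<phi> ^ n"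
        by (simp add: D mult_ac)
      also have "\<dots> = geom_powr q fps_X (of_nat n * z)"
        using D0 by (simp add: inverse_mult_eq_1 \<phi>_def geom_powr_of_nat_mult)
      finally show ?thesis by (simp only: gen_multinomial_eq_nth[OF assms])
    qed
    then have "Abs_fps (\<lambda>n. gen_multinomial q (of_nat n * z) n) = inverse D oo u"
      by (simp add: fps_eq_iff)
    also have "\<dots> = inverse (D oo u)" using u0 D0 by (simp add: fps_inverse_compose)
    also have "D oo u = 1 - fps_const z * ((\<Sum>i=1..q. of_nat i * u ^ i) / (\<Sum>i=0..q. u ^ i))"
      using u0 S0[of fps_X]
      by (simp add: D_def fps_compose_sub_distrib fps_compose_mult_distrib fps_divide_compose
          fps_compose_sum_distrib fps_compose_power[symmetric] flip: fps_of_nat)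
    finally show ?thesis .
  qed
  then show ?thesis by (simp add: solves)
qed

end
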